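(* Let $\theta\neq0$ be the true parameter, let $(\hat\theta_n)_{n\ge1}$ be a sequence of real-valued estimators of $\theta$, let $\hat\sigma_\theta^2$ (depending on $n$) be an estimator of the asymptotic variance parameter $\sigma_\theta^2$, and let $R_\theta$ be the surrogate reward function. Suppose that the estimators satisfy, as $n\to\infty$: - $\sigma_n^2:=\mathbb{E}[(\hat\theta_n-\theta)^2]$ satisfies $\lim_{n\to\infty}n\sigma_n^2=\sigma_\theta^2$ for some constant $\sigma_\theta^2>0$; - $|\mathbb{E}[\hat\theta_n-\theta]|=o(n^{-1})$; - $\mathbb{E}[|\hat\theta_n-\theta|^k]=O(n^{-k/2})$ for $k=3,4,\dots$. Suppose that, for any true parameter $\theta$ in its domain, the surrogate reward satisfies: - $R^{(1)}_\theta(\theta)=0$ and $R^{(2)}_\theta(\theta)<0$; - there exists a constant $C$, independent of $\theta$, such that $R^{(3)}_\theta(\theta)/R^{(2)}_\theta(\theta)=C/\theta$; - $|R^{(5)}_\theta(x)|\le M$ for some constant $M$ and for all $x$ on the interval between $\theta$ and $\hat\theta_n$ (this implicitly assumes the existence of all derivatives up to order five). Suppose that $\hat\sigma_\theta^2$ is a consistent estimator of $\sigma_\theta^2$ satisfying: - $\mathbb{E}[\hat\sigma_\theta^2-\sigma_\theta^2]=o(n^{-1})$; - $\mathbb{E}[(\hat\sigma_\theta^2-\sigma_\theta^2)^j]=O(n^{-j})$ for $j=2,3,\dots$; - $\mathbb{E}[(\hat\theta_n-\theta)(\hat\sigma_\theta^2-\sigma_\theta^2)]=o(n^{-1})$.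 Suppose finally that there exists a constant $\varepsilon>0$ such that $\Pr\{|\hat\theta_n|\ge\varepsilon\}=1$ for all $n$. If we choose the adjustment coefficient $$\lambda_n^\ast=\frac{(2-C)\hat\sigma_\theta^2}{2\hat\theta_n^2},$$ then $$\lim_{n\to\infty} n^2\left(\mathbb{E}\left[R_{\theta}\left(\hat\theta_n\left(1+\frac{\lambda_n^\ast}{n}\right)\right)\right]-\mathbb{E}[R_{\theta}(\hat\theta_n)]\right)=-\frac{R^{(2)}_{\theta}(\theta)(2-C)^2\sigma_\theta^4}{8\theta^2}\ge 0.$$
   Context: $\theta$ is an unknown scalar parameter and $\hat\theta_n$ is an estimator of $\theta$ computed from a dataset of size $n$; $\hat\sigma_\theta^2$ is computed from the same dataset; expectations are over the sampling distribution. The surrogate reward is a real-valued function $R_\theta(\cdot)$ of the estimate (it arises as $R_\theta(\hat\theta)=F(z(\hat\theta),\theta)$, where $F(z,\theta)$ is the reward of decision $z$ and $z(\theta)=\arg\max_z F(z,\theta)$). $R_\theta^{(k)}(x)$ denotes the $k$-th derivative of $R_\theta(x)$ with respect to its argument $x$.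
   Formalization: The bound |R^(5)_θ(x)| ≤ M is also assumed, at the true θ, for x between θ and the adjusted estimate θ̂_n(1+λ_n*/n); without such a condition the adjusted expected reward can be −∞ and the claim fails. *)

theory Defs
  imports "HOL-Probability.Probability" "HOL-Library.Landau_Symbols"
begin

text \<open>
  The classical, pointwise notion: a function has a derivative of order \<open>k + 1\<close> at \<open>x\<close> if its
  derivative of order \<open>k\<close> exists in a neighbourhood of \<open>x\<close> and is differentiable at \<open>x\<close>.
  The neighbourhood is needed because \<^const>\<open>deriv\<close> takes an unspecified value at points where
  its argument is not differentiable.
\<close>

primrec times_differentiable_at :: "nat \<Rightarrow> (real \<Rightarrow> real) \<Rightarrow> real \<Rightarrow> bool" where
  "times_differentiable_at 0 f x \<longleftrightarrow> True"
| "times_differentiable_at (Suc k) f x \<longleftrightarrow>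
     (\<forall>\<^sub>F y in nhds x. times_differentiable_at k f y) \<and> (deriv ^^ k) f differentiable (at x)"

text \<open>
  The constant is uniform in the sample size, and the interval between \<open>t\<close> and the estimate is
  random, so the bound is required almost surely.
\<close>

definition bounded_fifth_deriv_between ::
    "(real \<Rightarrow> real) \<Rightarrow> 'a measure \<Rightarrow> real \<Rightarrow> (nat \<Rightarrow> 'a \<Rightarrow> real) \<Rightarrow> bool" where
  "bounded_fifth_deriv_between f M t X \<longleftrightarrow>
     (\<exists>B. \<forall>n\<ge>1. AE \<omega> in M. \<forall>x\<in>closed_segment t (X n \<omega>).
        times_differentiable_at 5 f x \<and> \<bar>(deriv ^^ 5) f x\<bar> \<le> B)"

definition consistent_estimator :: "'a measure \<Rightarrow> (nat \<Rightarrow> 'a \<Rightarrow> real) \<Rightarrow> real \<Rightarrow> bool" where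
  "consistent_estimator M X c \<longleftrightarrow>
     (\<forall>e>0. (\<lambda>n. measure M {\<omega> \<in> space M. \<bar>X n \<omega> - c\<bar> > e}) \<longlonglongrightarrow> 0)"

text \<open>Below, \<open>t\<close> is the estimate of the parameter and \<open>s\<close> the estimate of the asymptotic variance.\<close>

definition adjustment_coeff :: "real \<Rightarrow> real \<Rightarrow> real \<Rightarrow> real" where
  "adjustment_coeff C t s = (2 - C) * s / (2 * t\<^sup>2)"

definition adjusted_estimate :: "real \<Rightarrow> nat \<Rightarrow> real \<Rightarrow> real \<Rightarrow> real" where
  "adjusted_estimate C n t s = t * (1 + adjustment_coeff C t s / real n)"

end

theory Submission
  imports Defs "HOL-Real_Asymp.Real_Asymp"
begin

text \<open>
  Write \<open>X\<close> for the error of the estimate, \<open>s\<close> for the variance estimate, \<open>u = 1 / (\<theta> + X)\<close> and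
  \<open>a = (2 - C) / 2\<close>; the adjustment moves the estimate by \<open>a s u / n\<close>. Both rewards are expanded
  at \<open>\<theta>\<close> to fourth order. Repeatedly substituting \<open>u = 1 / \<theta> - X u / \<theta>\<close> turns \<open>n\<^sup>2\<close> times their
  difference into a combination of \<open>n s X\<close>, \<open>n s X\<^sup>2\<close> and \<open>s\<^sup>2\<close>, whose expectations tend to \<open>0\<close>,
  \<open>\<sigma>\<^sup>4\<close> and \<open>\<sigma>\<^sup>4\<close>, plus terms \<open>n\<^sup>p X\<^sup>i s\<^sup>j u\<^sup>k\<close> with \<open>p < i / 2\<close>. The latter vanish in \<open>L\<^sup>1\<close>, because
  \<open>u\<close> is bounded and \<open>X\<close> has size \<open>n\<^sup>-\<^sup>1\<^sup>/\<^sup>2\<close> in every moment, and the Taylor remainders are bounded by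
  terms of this kind. The condition on the third derivative makes the limit a negative multiple
  of \<open>a\<^sup>2\<close> times the second derivative.
\<close>

subsection \<open>Taylor expansion\<close>

text \<open>Induction on \<open>n\<close>: the top order is the second clause of the definition, and
  lower orders come from its neighbourhood clause, which in particular holds at \<open>x\<close>
  itself.\<close>

lemma times_differentiable_at_has_derivative:
  assumes "times_differentiable_at n f x" "m < n"
  shows "((deriv ^^ m) f has_real_derivative (deriv ^^ Suc m) f x) (at x)"
  using assms
proof (induction n)
  case (Suc n)
  show ?case
  proof (cases "m = n")
    case True
    with Suc.prems show ?thesis
      by (auto simp: DERIV_deriv_iff_real_differentiable)
  next
    case False
    with Suc show ?thesis
      by (auto dest: eventually_nhds_x_imp_x)
  qed
qed simp

text \<open>Lagrange's form of the remainder: the intermediate point lies on the segment, where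
  \<open>B\<close> bounds the derivative. The case \<open>x = t\<close> is separate because
  \<open>Taylor\<close> expects distinct points.\<close>

lemma taylor_remainder_le:
  fixes f :: "real \<Rightarrow> real"
  assumes "n > 0"
    and diff: "\<And>y. y \<in> closed_segment t x \<Longrightarrow> times_differentiable_at n f y"
    and bound: "\<And>y. y \<in> closed_segment t x \<Longrightarrow> \<bar>(deriv ^^ n) f y\<bar> \<le> B"
  shows "\<bar>f x - (\<Sum>m<n. (deriv ^^ m) f t / fact m * (x - t) ^ m)\<bar> \<le> B / fact n * \<bar>x - t\<bar> ^ n"
proof (cases "x = t")
  case True
  have "(\<Sum>m<n. (deriv ^^ m) f t / fact m * (x - t) ^ m) = (\<Sum>m<n. if m = 0 then f t else 0)"
    using True by (intro sum.cong) auto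
  then show ?thesis
    using True \<open>n > 0\<close> by (simp add: power_0_left)
next
  case False
  have seg: "closed_segment t x = {min t x..max t x}"
    by (auto simp: closed_segment_eq_real_ivl)
  obtain y where y: "if x < t then x < y \<and> y < t else t < y \<and> y < x"
    and eq: "f x = (\<Sum>m<n. (deriv ^^ m) f t / fact m * (x - t) ^ m)
               + (deriv ^^ n) f y / fact n * (x - t) ^ n"
    using Taylor[of n "\<lambda>m. (deriv ^^ m) f" f "min t x" "max t x" t x] False \<open>n > 0\<close>
      times_differentiable_at_has_derivative[OF diff] seg
    by (auto simp del: funpow.simps)
  have "y \<in> closed_segment t x"
    using y unfolding seg by (auto split: if_splits)
  then have "\<bar>(deriv ^^ n) f y\<bar> \<le> B"
    by (rule bound)
  then have "\<bar>(deriv ^^ n) f y / fact n * (x - t) ^ n\<bar> \<le> B / fact n * \<bar>x - t\<bar> ^ n"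
    by (auto simp: abs_mult power_abs intro!: mult_right_mono divide_right_mono)
  then show ?thesis
    by (simp add: eq)
qed

text \<open>The constant depends neither on the sample size nor on the outcome, so it can later be
  pulled out of expectations and limits. It is the derivative bound divided by
  \<open>fact 5\<close>.\<close>

lemma bounded_fifth_deriv_between_taylor:
  assumes "bounded_fifth_deriv_between f M t Z"
  obtains B where "\<And>n. n \<ge> 1 \<Longrightarrow> AE \<omega> in M.
    \<bar>f (Z n \<omega>) - (\<Sum>m<5. (deriv ^^ m) f t / fact m * (Z n \<omega> - t) ^ m)\<bar> \<le> B * \<bar>Z n \<omega> - t\<bar> ^ 5"
proof -
  from assms obtain B where B: "\<And>n. n \<ge> 1 \<Longrightarrow> AE \<omega> in M. \<forall>x\<in>closed_segment t (Z n \<omega>).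
      times_differentiable_at 5 f x \<and> \<bar>(deriv ^^ 5) f x\<bar> \<le> B"
    unfolding bounded_fifth_deriv_between_def by blast
  show thesis
  proof (rule that[of "B / fact 5"])
    show "AE \<omega> in M. \<bar>f (Z n \<omega>) - (\<Sum>m<5. (deriv ^^ m) f t / fact m * (Z n \<omega> - t) ^ m)\<bar>
        \<le> B / fact 5 * \<bar>Z n \<omega> - t\<bar> ^ 5" if "n \<ge> 1" for n
      using B[OF that]
    proof eventually_elim
      case (elim \<omega>)
      then show ?case
        by (intro taylor_remainder_le) auto
    qed
  qed
qed

subsection \<open>Moment bounds and convergence to zero in mean\<close>

text \<open>A sum is at most twice the larger summand. This splits powers of a sum of two random
  quantities into pure powers, whose moments are under control.\<close>

lemma abs_add_power_le:
  fixes a b :: real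
  shows "\<bar>a + b\<bar> ^ k \<le> 2 ^ k * (\<bar>a\<bar> ^ k + \<bar>b\<bar> ^ k)"
proof -
  have "\<bar>a + b\<bar> ^ k \<le> (2 * max \<bar>a\<bar> \<bar>b\<bar>) ^ k"
    by (intro power_mono) auto
  also have "\<dots> \<le> 2 ^ k * (\<bar>a\<bar> ^ k + \<bar>b\<bar> ^ k)"
    by (auto simp: power_mult_distrib max_def)
  finally show ?thesis .
qed

text \<open>Young's inequality with a free weight, from expanding a square. One of the two cross
  terms is given away, which costs only a constant factor.\<close>

lemma abs_mult_le_weighted_squares:
  fixes y w c :: real
  assumes "c > 0"
  shows "\<bar>y * w\<bar> \<le> c * y\<^sup>2 + w\<^sup>2 / c"
proof -
  have "0 \<le> (c * \<bar>y\<bar> - \<bar>w\<bar>)\<^sup>2 + c * \<bar>y * w\<bar>"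
    using assms by (auto intro!: add_nonneg_nonneg mult_nonneg_nonneg)
  also have "\<dots> = c\<^sup>2 * y\<^sup>2 + w\<^sup>2 - c * \<bar>y * w\<bar>"
    by (simp add: power2_eq_square algebra_simps abs_mult)
  finally have "c * \<bar>y * w\<bar> \<le> c * (c * y\<^sup>2 + w\<^sup>2 / c)"
    using assms by (simp add: power2_eq_square algebra_simps)
  then show ?thesis
    using assms by simp
qed

lemma integrable_mult_squares:
  fixes Y W :: "'a \<Rightarrow> real"
  assumes "Y \<in> borel_measurable M" "W \<in> borel_measurable M"
    and "integrable M (\<lambda>x. (Y x)\<^sup>2)" "integrable M (\<lambda>x. (W x)\<^sup>2)"
  shows "integrable M (\<lambda>x. Y x * W x)"
proof (rule Bochner_Integration.integrable_bound)
  show "integrable M (\<lambda>x. (Y x)\<^sup>2 + (W x)\<^sup>2)"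
    using assms by auto
  show "AE x in M. norm (Y x * W x) \<le> norm ((Y x)\<^sup>2 + (W x)\<^sup>2)"
    using abs_mult_le_weighted_squares[of 1] by auto
qed (use assms in auto)

text \<open>\<open>p\<close> and \<open>q\<close> are the orders of the root mean squares, which add
  up under multiplication. Mixed moments are thus controlled by second moments of the two
  factors.\<close>

lemma integral_abs_mult_bigo:
  fixes Y W :: "nat \<Rightarrow> 'a \<Rightarrow> real" and p q :: real
  assumes meas: "\<And>n. n \<ge> 1 \<Longrightarrow> Y n \<in> borel_measurable M" "\<And>n. n \<ge> 1 \<Longrightarrow> W n \<in> borel_measurable M"
    and int: "\<And>n. n \<ge> 1 \<Longrightarrow> integrable M (\<lambda>x. (Y n x)\<^sup>2)" "\<And>n. n \<ge> 1 \<Longrightarrow> integrable M (\<lambda>x. (W n x)\<^sup>2)"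
    and Y: "(\<lambda>n. \<integral>x. (Y n x)\<^sup>2 \<partial>M) \<in> O(\<lambda>n. real n powr (2 * p))"
    and W: "(\<lambda>n. \<integral>x. (W n x)\<^sup>2 \<partial>M) \<in> O(\<lambda>n. real n powr (2 * q))"
  shows "(\<lambda>n. \<integral>x. \<bar>Y n x * W n x\<bar> \<partial>M) \<in> O(\<lambda>n. real n powr (p + q))"
proof -
  define B where "B n = real n powr (q - p) * (\<integral>x. (Y n x)\<^sup>2 \<partial>M)
    + real n powr (p - q) * (\<integral>x. (W n x)\<^sup>2 \<partial>M)" for n
  have "eventually (\<lambda>n. norm (\<integral>x. \<bar>Y n x * W n x\<bar> \<partial>M) \<le> norm (B n)) sequentially"
    using eventually_ge_at_top[of 1]
  proof eventually_elim
    case (elim n)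
    \<comment> \<open>this weight balances the two squares, which replaces the Cauchy-Schwarz inequality\<close>
    define c where "c = real n powr (q - p)"
    have "c > 0"
      using elim by (simp add: c_def)
    have "(\<integral>x. \<bar>Y n x * W n x\<bar> \<partial>M) \<le> (\<integral>x. c * (Y n x)\<^sup>2 + (W n x)\<^sup>2 / c \<partial>M)"
      using elim meas int \<open>c > 0\<close>
      by (intro integral_mono abs_mult_le_weighted_squares integrable_abs integrable_mult_squares) auto
    also have "\<dots> = c * (\<integral>x. (Y n x)\<^sup>2 \<partial>M) + (\<integral>x. (W n x)\<^sup>2 \<partial>M) / c"
      using elim int by simp
    also have "\<dots> = B n"
      using elim by (simp add: B_def c_def powr_diff field_simps)
    finally show ?case
      by simp
  qed
  then have "(\<lambda>n. \<integral>x. \<bar>Y n x * W n x\<bar> \<partial>M) \<in> O(B)"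
    by (rule landau_o.big_mono)
  also have "B \<in> O(\<lambda>n. real n powr (p + q))"
    unfolding B_def
  proof (rule sum_in_bigo)
    have "(\<lambda>n. real n powr (q - p) * (\<integral>x. (Y n x)\<^sup>2 \<partial>M)) \<in> O(\<lambda>n. real n powr (q - p) * real n powr (2 * p))"
      by (intro landau_o.big.mult Y) simp
    then show "(\<lambda>n. real n powr (q - p) * (\<integral>x. (Y n x)\<^sup>2 \<partial>M)) \<in> O(\<lambda>n. real n powr (p + q))"
      by (simp add: add_ac flip: powr_add)
    have "(\<lambda>n. real n powr (p - q) * (\<integral>x. (W n x)\<^sup>2 \<partial>M)) \<in> O(\<lambda>n. real n powr (p - q) * real n powr (2 * q))"
      by (intro landau_o.big.mult W) simp
    then show "(\<lambda>n. real n powr (p - q) * (\<integral>x. (W n x)\<^sup>2 \<partial>M)) \<in> O(\<lambda>n. real n powr (p + q))"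
      by (simp add: add_ac flip: powr_add)
  qed
  finally show ?thesis .
qed

lemma powr_mult_bigo_tendsto_zero:
  fixes f :: "nat \<Rightarrow> real"
  assumes "f \<in> O(\<lambda>n. real n powr q)" "p + q < 0"
  shows "(\<lambda>n. real n powr p * f n) \<longlonglongrightarrow> 0"
proof -
  have "(\<lambda>n. real n powr p * f n) \<in> O(\<lambda>n. real n powr p * real n powr q)"
    by (intro landau_o.big.mult assms(1)) simp
  also have "(\<lambda>n. real n powr p * real n powr q) = (\<lambda>n. real n powr (p + q))"
    by (simp add: powr_add)
  also have "(\<lambda>n. real n powr (p + q)) \<in> o(\<lambda>n. 1)"
    using assms(2) tendsto_neg_powr[OF assms(2) filterlim_real_sequentially]
    by (intro smalloI_tendsto) auto
  finally show ?thesis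
    by (auto dest: smalloD_tendsto)
qed

text \<open>The integrability clause gives the limit its meaning: the integral of a function that is
  not integrable is 0 by convention. Sample sizes start at 1.\<close>

definition L1_null :: "'a measure \<Rightarrow> (nat \<Rightarrow> 'a \<Rightarrow> real) \<Rightarrow> bool" where
  "L1_null M Y \<longleftrightarrow> (\<forall>n\<ge>1. integrable M (Y n)) \<and> (\<lambda>n. \<integral>x. \<bar>Y n x\<bar> \<partial>M) \<longlonglongrightarrow> 0"

lemma L1_null_integrable: "L1_null M Y \<Longrightarrow> n \<ge> 1 \<Longrightarrow> integrable M (Y n)"
  by (simp add: L1_null_def)

lemma L1_null_tendsto:
  assumes "L1_null M Y"
  shows "(\<lambda>n. \<integral>x. Y n x \<partial>M) \<longlonglongrightarrow> 0"
proof (rule Lim_null_comparison)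
  show "(\<lambda>n. \<integral>x. \<bar>Y n x\<bar> \<partial>M) \<longlonglongrightarrow> 0"
    using assms by (simp add: L1_null_def)
qed (auto simp: integral_abs_bound)

text \<open>Domination yields integrability and the limit at once. An almost sure bound suffices, as
  the estimates are bounded away from 0 and expanded only almost surely.\<close>

lemma L1_null_bound:
  assumes Z: "L1_null M Z"
    and meas: "\<And>n. n \<ge> 1 \<Longrightarrow> Y n \<in> borel_measurable M"
    and le: "\<And>n. n \<ge> 1 \<Longrightarrow> AE x in M. \<bar>Y n x\<bar> \<le> Z n x"
  shows "L1_null M Y"
proof -
  have int: "integrable M (Y n)" if "n \<ge> 1" for n
    using le[OF that]
    by (intro Bochner_Integration.integrable_bound[OF L1_null_integrable[OF Z that] meas[OF that]]) auto
  have "(\<lambda>n. \<integral>x. \<bar>Y n x\<bar> \<partial>M) \<longlonglongrightarrow> 0"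
  proof (rule Lim_null_comparison)
    show "eventually (\<lambda>n. norm (\<integral>x. \<bar>Y n x\<bar> \<partial>M) \<le> (\<integral>x. Z n x \<partial>M)) sequentially"
      using eventually_ge_at_top[of 1]
    proof eventually_elim
      case (elim n)
      then show ?case
        using int L1_null_integrable[OF Z] le by (auto intro!: integral_mono_AE)
    qed
    show "(\<lambda>n. \<integral>x. Z n x \<partial>M) \<longlonglongrightarrow> 0"
      by (rule L1_null_tendsto[OF Z])
  qed
  with int show ?thesis
    by (simp add: L1_null_def)
qed

lemma L1_null_abs:
  assumes "L1_null M Y"
  shows "L1_null M (\<lambda>n x. \<bar>Y n x\<bar>)"
  using assms by (auto simp: L1_null_def)

lemma L1_null_cmult:
  assumes "L1_null M Y"
  shows "L1_null M (\<lambda>n x. c * Y n x)"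
  using assms tendsto_mult_right_zero[of _ sequentially "\<bar>c\<bar>"] by (auto simp: L1_null_def abs_mult)

lemma L1_null_add:
  assumes "L1_null M Y" "L1_null M Z"
  shows "L1_null M (\<lambda>n x. Y n x + Z n x)"
proof (rule L1_null_bound)
  have "(\<lambda>n. (\<integral>x. \<bar>Y n x\<bar> \<partial>M) + (\<integral>x. \<bar>Z n x\<bar> \<partial>M)) \<longlonglongrightarrow> 0"
    using assms by (auto simp: L1_null_def intro: tendsto_add_zero)
  moreover have "eventually (\<lambda>n. (\<integral>x. \<bar>Y n x\<bar> \<partial>M) + (\<integral>x. \<bar>Z n x\<bar> \<partial>M)
      = (\<integral>x. \<bar>\<bar>Y n x\<bar> + \<bar>Z n x\<bar>\<bar> \<partial>M)) sequentially"
    using eventually_ge_at_top[of 1]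
    by eventually_elim (use assms in \<open>simp add: L1_null_def\<close>)
  ultimately have "(\<lambda>n. \<integral>x. \<bar>\<bar>Y n x\<bar> + \<bar>Z n x\<bar>\<bar> \<partial>M) \<longlonglongrightarrow> 0"
    by (rule Lim_transform_eventually)
  then show "L1_null M (\<lambda>n x. \<bar>Y n x\<bar> + \<bar>Z n x\<bar>)"
    using assms by (auto simp: L1_null_def)
qed (use assms in \<open>auto simp: L1_null_def intro!: borel_measurable_add borel_measurable_integrable\<close>)

text \<open>Only even moments are bounded: they need no absolute values, and they are what the
  squares in \<open>integral_abs_mult_bigo\<close> produce. \<open>X\<close> has order
  \<open>n powr (-1/2)\<close>, \<open>s\<close> is bounded in every moment and \<open>u\<close> is
  bounded outright.\<close>

locale moment_bounds = prob_space M for M :: "'a measure" +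
  fixes X s u :: "nat \<Rightarrow> 'a \<Rightarrow> real" and b :: real
  assumes X_measurable [measurable]: "n \<ge> 1 \<Longrightarrow> X n \<in> borel_measurable M"
    and s_measurable [measurable]: "n \<ge> 1 \<Longrightarrow> s n \<in> borel_measurable M"
    and u_measurable [measurable]: "n \<ge> 1 \<Longrightarrow> u n \<in> borel_measurable M"
    and X_integrable: "n \<ge> 1 \<Longrightarrow> integrable M (\<lambda>x. X n x ^ k)"
    and s_integrable: "n \<ge> 1 \<Longrightarrow> integrable M (\<lambda>x. s n x ^ k)"
    and X_moments: "(\<lambda>n. \<integral>x. X n x ^ (2 * k) \<partial>M) \<in> O(\<lambda>n. real n powr (- real k))"
    and s_moments: "(\<lambda>n. \<integral>x. s n x ^ (2 * k) \<partial>M) \<in> O(\<lambda>n. 1)"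
    and u_bound: "n \<ge> 1 \<Longrightarrow> AE x in M. \<bar>u n x\<bar> \<le> b"
begin

lemma integrable_X_s:
  assumes "n \<ge> 1"
  shows "integrable M (\<lambda>x. X n x ^ i * s n x ^ j)"
  using assms X_integrable[of n "2 * i"] s_integrable[of n "2 * j"]
  by (intro integrable_mult_squares) (auto simp: power_mult power2_eq_square power_mult_distrib)

text \<open>The root mean square of \<open>X ^ i\<close> has order \<open>n powr (- i / 2)\<close>
  and that of \<open>s ^ j\<close> is bounded, so the mean of the absolute value has order
  \<open>n powr (p - i / 2)\<close>, a negative power.\<close>

lemma L1_null_X_s:
  assumes "p < real i / 2"
  shows "L1_null M (\<lambda>n x. real n powr p * (X n x ^ i * s n x ^ j))"
proof -
  have "(\<lambda>n. \<integral>x. \<bar>X n x ^ i * s n x ^ j\<bar> \<partial>M) \<in> O(\<lambda>n. real n powr (- real i / 2 + 0))"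
  proof (rule integral_abs_mult_bigo)
    show "(\<lambda>n. \<integral>x. (X n x ^ i)\<^sup>2 \<partial>M) \<in> O(\<lambda>n. real n powr (2 * (- real i / 2)))"
      using X_moments[of i] by (simp add: mult.commute flip: power_mult)
    have "(\<lambda>n. \<integral>x. (s n x ^ j)\<^sup>2 \<partial>M) \<in> O(\<lambda>n. 1)"
      using s_moments[of j] by (simp add: mult.commute flip: power_mult)
    \<comment> \<open>The comparison holds only for positive \<open>n\<close>, since
      \<open>0 powr 0 = 0\<close>.\<close>
    also have "(\<lambda>n. 1) \<in> O(\<lambda>n. real n powr (2 * 0))"
      by (intro landau_o.big_mono eventually_mono[OF eventually_gt_at_top[of 0]]) simp
    finally show "(\<lambda>n. \<integral>x. (s n x ^ j)\<^sup>2 \<partial>M) \<in> O(\<lambda>n. real n powr (2 * 0))" .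
  qed (use X_integrable s_integrable in \<open>auto simp flip: power_mult\<close>)
  then have "(\<lambda>n. real n powr p * (\<integral>x. \<bar>X n x ^ i * s n x ^ j\<bar> \<partial>M)) \<longlonglongrightarrow> 0"
    using assms by (intro powr_mult_bigo_tendsto_zero) auto
  moreover have "(\<integral>x. \<bar>real n powr p * (X n x ^ i * s n x ^ j)\<bar> \<partial>M)
      = real n powr p * (\<integral>x. \<bar>X n x ^ i * s n x ^ j\<bar> \<partial>M)" for n
    by (simp add: abs_mult)
  ultimately show ?thesis
    by (auto simp: L1_null_def integrable_X_s)
qed

lemma L1_null_X_s_u:
  assumes "p < real i / 2"
  shows "L1_null M (\<lambda>n x. real n powr p * (X n x ^ i * s n x ^ j * u n x ^ k))"
proof (rule L1_null_bound)
  show "L1_null M (\<lambda>n x. b ^ k * \<bar>real n powr p * (X n x ^ i * s n x ^ j)\<bar>)"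
    by (intro L1_null_cmult L1_null_abs L1_null_X_s assms)
  show "AE x in M. \<bar>real n powr p * (X n x ^ i * s n x ^ j * u n x ^ k)\<bar>
      \<le> b ^ k * \<bar>real n powr p * (X n x ^ i * s n x ^ j)\<bar>" if "n \<ge> 1" for n
    using u_bound[OF that]
  proof eventually_elim
    case (elim x)
    have "\<bar>real n powr p * (X n x ^ i * s n x ^ j * u n x ^ k)\<bar>
        = \<bar>u n x\<bar> ^ k * \<bar>real n powr p * (X n x ^ i * s n x ^ j)\<bar>"
      by (simp add: abs_mult power_abs)
    also have "\<dots> \<le> b ^ k * \<bar>real n powr p * (X n x ^ i * s n x ^ j)\<bar>"
      using elim by (intro mult_right_mono power_mono) auto
    finally show ?case .
  qed
qed measurable

end

text \<open>\<open>F\<close> is a polynomial in \<open>Y\<close> plus a remainder dominated by a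
  multiple of \<open>\<bar>Y\<bar> ^ n\<close>; both are integrable because \<open>Y\<close> has all
  moments.\<close>

lemma integrable_of_taylor_bound:
  fixes Y F :: "'a \<Rightarrow> real"
  assumes "F \<in> borel_measurable M"
    and Y: "\<And>k. integrable M (\<lambda>x. Y x ^ k)"
    and bound: "AE x in M. \<bar>F x - (\<Sum>m<n. c m * Y x ^ m)\<bar> \<le> K * \<bar>Y x\<bar> ^ n"
  shows "integrable M F"
proof -
  have T: "integrable M (\<lambda>x. \<Sum>m<n. c m * Y x ^ m)"
    using Y by auto
  have "integrable M (\<lambda>x. F x - (\<Sum>m<n. c m * Y x ^ m))"
  proof (rule Bochner_Integration.integrable_bound)
    show "integrable M (\<lambda>x. K * \<bar>Y x\<bar> ^ n)"
      using integrable_abs[OF Y[of n]] by (simp add: power_abs)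
  qed (use bound assms(1) borel_measurable_integrable[OF T] in auto)
  from Bochner_Integration.integrable_add[OF this T] show ?thesis
    by simp
qed

subsection \<open>Expansion of the adjusted reward\<close>

text \<open>An exact identity. In the first three summands on the right no \<open>u\<close> is left;
  in every other one the power of \<open>N\<close> is less than half the power of \<open>X\<close>,
  which is the condition of \<open>L1_null_X_s_u\<close>.\<close>

lemma adjustment_expansion:
  fixes X s u \<theta> a N c\<^sub>2 c\<^sub>3 c\<^sub>4 :: real
  assumes u: "u * (\<theta> + X) = 1" and "\<theta> \<noteq> 0" "N \<noteq> 0"
  defines "D \<equiv> X + a * s * u / N"
  shows "N\<^sup>2 * (c\<^sub>2 / 2 * (D\<^sup>2 - X\<^sup>2) + c\<^sub>3 / 6 * (D ^ 3 - X ^ 3) + c\<^sub>4 / 24 * (D ^ 4 - X ^ 4)) =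
    c\<^sub>2 * a / \<theta> * (N * (s * X)) + (c\<^sub>3 * a / (2 * \<theta>) - c\<^sub>2 * a / \<theta>\<^sup>2) * (N * (s * X\<^sup>2))
      + c\<^sub>2 * a\<^sup>2 / (2 * \<theta>\<^sup>2) * s\<^sup>2
    + (c\<^sub>2 * a / \<theta>\<^sup>2 - c\<^sub>3 * a / (2 * \<theta>) + c\<^sub>4 * a / 6) * (N * (X ^ 3 * s * u))
    + (c\<^sub>3 * a\<^sup>2 / 2 - c\<^sub>2 * a\<^sup>2 / \<theta>) * (X * s\<^sup>2 * u\<^sup>2)
    + (c\<^sub>4 * a\<^sup>2 / 4 - c\<^sub>2 * a\<^sup>2 / (2 * \<theta>\<^sup>2)) * (X\<^sup>2 * s\<^sup>2 * u\<^sup>2)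
    + c\<^sub>3 * a ^ 3 / 6 * (s ^ 3 * u ^ 3 / N)
    + c\<^sub>4 * a ^ 3 / 6 * (X * s ^ 3 * u ^ 3 / N)
    + c\<^sub>4 * a ^ 4 / 24 * (s ^ 4 * u ^ 4 / N\<^sup>2)"
proof -
  \<comment> \<open>Scaling the shift by \<open>N\<close> hides \<open>u\<close> during the binomial
    expansions.\<close>
  define w where "w = a * s * u"
  have D: "D = X + w / N"
    by (simp add: D_def w_def)
  have d2: "N\<^sup>2 * (D\<^sup>2 - X\<^sup>2) = 2 * N * X * w + w\<^sup>2"
    using \<open>N \<noteq> 0\<close> unfolding D by (simp add: field_simps power2_eq_square)
  have d3: "N\<^sup>2 * (D ^ 3 - X ^ 3) = 3 * N * X\<^sup>2 * w + 3 * X * w\<^sup>2 + w ^ 3 / N"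
    using \<open>N \<noteq> 0\<close> unfolding D by (simp add: field_simps eval_nat_numeral)
  have d4: "N\<^sup>2 * (D ^ 4 - X ^ 4) = 4 * N * X ^ 3 * w + 6 * X\<^sup>2 * w\<^sup>2 + 4 * X * w ^ 3 / N + w ^ 4 / N\<^sup>2"
    using \<open>N \<noteq> 0\<close> unfolding D by (simp add: field_simps eval_nat_numeral)
  have u1: "u = 1 / \<theta> - X * u / \<theta>"
    using assms(1,2) by (simp add: field_simps)
  have u\<theta>: "\<theta> * u = 1 - X * u"
    using u by (simp add: algebra_simps)
  \<comment> \<open>The relation \<open>u\<theta>\<close> is used twice, so that the remaining
    \<open>u\<close> carries a factor \<open>X\<^sup>2\<close>.\<close>
  have "\<theta>\<^sup>2 * u = \<theta> * (\<theta> * u)"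
    by (simp add: power2_eq_square)
  also have "\<dots> = \<theta> * (1 - X * u)"
    by (simp only: u\<theta>)
  also have "\<dots> = \<theta> - X * (\<theta> * u)"
    by (simp add: algebra_simps)
  also have "\<dots> = \<theta> - X * (1 - X * u)"
    by (simp only: u\<theta>)
  finally have "u = (\<theta> - X * (1 - X * u)) / \<theta>\<^sup>2"
    using \<open>\<theta> \<noteq> 0\<close> by (simp add: eq_divide_eq mult.commute)
  also have "\<dots> = 1 / \<theta> - X / \<theta>\<^sup>2 + X\<^sup>2 * u / \<theta>\<^sup>2"
    using \<open>\<theta> \<noteq> 0\<close> by (simp add: field_simps power2_eq_square)
  finally have u2: "u = 1 / \<theta> - X / \<theta>\<^sup>2 + X\<^sup>2 * u / \<theta>\<^sup>2" .
  \<comment> \<open>Squaring the relation expresses \<open>u\<^sup>2\<close> by its leading value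
    and terms that each contain a factor \<open>X\<close>.\<close>
  have "(u * (\<theta> + X))\<^sup>2 = 1"
    by (simp add: u)
  then have "u\<^sup>2 * \<theta>\<^sup>2 = 1 - 2 * X * \<theta> * u\<^sup>2 - X\<^sup>2 * u\<^sup>2"
    by (simp add: algebra_simps power2_eq_square)
  then have "u\<^sup>2 = (1 - 2 * X * \<theta> * u\<^sup>2 - X\<^sup>2 * u\<^sup>2) / \<theta>\<^sup>2"
    using \<open>\<theta> \<noteq> 0\<close> by (simp add: eq_divide_eq)
  also have "\<dots> = 1 / \<theta>\<^sup>2 - 2 * X * u\<^sup>2 / \<theta> - X\<^sup>2 * u\<^sup>2 / \<theta>\<^sup>2"
    using \<open>\<theta> \<noteq> 0\<close> by (simp add: field_simps power2_eq_square)
  finally have u3: "u\<^sup>2 = 1 / \<theta>\<^sup>2 - 2 * X * u\<^sup>2 / \<theta> - X\<^sup>2 * u\<^sup>2 / \<theta>\<^sup>2" .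
  \<comment> \<open>The first-order substitution would leave \<open>N * X\<^sup>2 * s * u\<close>,
    which is not negligible; the second-order one moves the last \<open>u\<close> to a term with
    \<open>X ^ 3\<close>.\<close>
  have t1: "N * X * w = a * (N * (s * X)) / \<theta> - a * (N * (s * X\<^sup>2)) / \<theta>\<^sup>2 + a * (N * (X ^ 3 * s * u)) / \<theta>\<^sup>2"
  proof -
    have "N * X * w = N * X * a * s * (1 / \<theta> - X / \<theta>\<^sup>2 + X\<^sup>2 * u / \<theta>\<^sup>2)"
      by (subst u2[symmetric]) (simp add: w_def)
    then show ?thesis
      by (simp add: algebra_simps eval_nat_numeral)
  qed
  \<comment> \<open>Here \<open>X\<^sup>2\<close> is already present, so the first-order
    substitution suffices.\<close>
  have t2: "N * X\<^sup>2 * w = a * (N * (s * X\<^sup>2)) / \<theta> - a * (N * (X ^ 3 * s * u)) / \<theta>"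
  proof -
    have "N * X\<^sup>2 * w = N * X\<^sup>2 * a * s * (1 / \<theta> - X * u / \<theta>)"
      by (subst u1[symmetric]) (simp add: w_def)
    then show ?thesis
      by (simp add: algebra_simps eval_nat_numeral)
  qed
  have t3: "w\<^sup>2 = a\<^sup>2 * s\<^sup>2 / \<theta>\<^sup>2 - 2 * a\<^sup>2 * (X * s\<^sup>2 * u\<^sup>2) / \<theta> - a\<^sup>2 * (X\<^sup>2 * s\<^sup>2 * u\<^sup>2) / \<theta>\<^sup>2"
  proof -
    have "w\<^sup>2 = a\<^sup>2 * s\<^sup>2 * (1 / \<theta>\<^sup>2 - 2 * X * u\<^sup>2 / \<theta> - X\<^sup>2 * u\<^sup>2 / \<theta>\<^sup>2)"
      by (subst u3[symmetric]) (simp add: w_def power_mult_distrib)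
    then show ?thesis
      by (simp add: algebra_simps)
  qed
  have "N\<^sup>2 * (c\<^sub>2 / 2 * (D\<^sup>2 - X\<^sup>2) + c\<^sub>3 / 6 * (D ^ 3 - X ^ 3) + c\<^sub>4 / 24 * (D ^ 4 - X ^ 4))
      = c\<^sub>2 / 2 * (N\<^sup>2 * (D\<^sup>2 - X\<^sup>2)) + c\<^sub>3 / 6 * (N\<^sup>2 * (D ^ 3 - X ^ 3)) + c\<^sub>4 / 24 * (N\<^sup>2 * (D ^ 4 - X ^ 4))"
    by (simp only: distrib_left mult_ac)
  \<comment> \<open>\<open>w\<close> stays folded exactly where \<open>u\<close> is still to be
    replaced; the other summands already have their final form.\<close>
  also have "\<dots> = c\<^sub>2 * (N * X * w) + c\<^sub>2 / 2 * w\<^sup>2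
      + c\<^sub>3 / 2 * (N * X\<^sup>2 * w) + c\<^sub>3 / 2 * (a\<^sup>2 * (X * s\<^sup>2 * u\<^sup>2)) + c\<^sub>3 / 6 * (a ^ 3 * s ^ 3 * u ^ 3 / N)
      + c\<^sub>4 / 6 * (a * (N * (X ^ 3 * s * u))) + c\<^sub>4 / 4 * (a\<^sup>2 * (X\<^sup>2 * s\<^sup>2 * u\<^sup>2))
      + c\<^sub>4 / 6 * (a ^ 3 * X * s ^ 3 * u ^ 3 / N) + c\<^sub>4 / 24 * (a ^ 4 * s ^ 4 * u ^ 4 / N\<^sup>2)"
    unfolding d2 d3 d4 by (simp add: w_def power_mult_distrib algebra_simps)
  finally show ?thesis
    unfolding t1 t2 t3 by (simp add: algebra_simps)
qed

text \<open>Integrability of all powers is assumed because a bound on an integral says nothing about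
  a function that is not integrable; for the same reason the conclusion asserts that both rewards
  are integrable. The fifth derivative is also bounded up to the adjusted estimate, since the reward
  is expanded there too. The estimators do not vary with the parameter; only the sampling
  distribution \<open>P t\<close> does.\<close>

theorem proposition3:
  fixes \<Theta> :: "real set"
    and P :: "real \<Rightarrow> 'a measure"
    and R :: "real \<Rightarrow> real \<Rightarrow> real"
    and est var_est :: "nat \<Rightarrow> 'a \<Rightarrow> real"
    and \<theta> \<sigma> C \<epsilon> :: real
  assumes prob: "\<And>t. t \<in> \<Theta> \<Longrightarrow> prob_space (P t)"
    and est_measurable: "\<And>t n. t \<in> \<Theta> \<Longrightarrow> n \<ge> 1 \<Longrightarrow> est n \<in> borel_measurable (P t)"
    and var_est_measurable: "\<And>t n. t \<in> \<Theta> \<Longrightarrow> n \<ge> 1 \<Longrightarrow> var_est n \<in> borel_measurable (P t)"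
    and reward_measurable: "\<And>t. t \<in> \<Theta> \<Longrightarrow> R t \<in> borel_measurable borel"
    and true_param: "\<theta> \<in> \<Theta>" "\<theta> \<noteq> 0"
    and est_integrable: "\<And>n k. n \<ge> 1 \<Longrightarrow> integrable (P \<theta>) (\<lambda>\<omega>. (est n \<omega> - \<theta>) ^ k)"
    and sigma_pos: "\<sigma>\<^sup>2 > 0"
    and est_mse: "(\<lambda>n. real n * (\<integral>\<omega>. (est n \<omega> - \<theta>)\<^sup>2 \<partial>P \<theta>)) \<longlonglongrightarrow> \<sigma>\<^sup>2"
    and est_bias: "(\<lambda>n. \<bar>\<integral>\<omega>. (est n \<omega> - \<theta>) \<partial>P \<theta>\<bar>) \<in> o(\<lambda>n. 1 / real n)"
    and est_moments: "\<And>k. k \<ge> 3 \<Longrightarrow>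
      (\<lambda>n. \<integral>\<omega>. \<bar>est n \<omega> - \<theta>\<bar> ^ k \<partial>P \<theta>) \<in> O(\<lambda>n. real n powr (- real k / 2))"
    and reward_deriv1: "\<And>t. t \<in> \<Theta> \<Longrightarrow> deriv (R t) t = 0"
    and reward_deriv2: "\<And>t. t \<in> \<Theta> \<Longrightarrow> (deriv ^^ 2) (R t) t < 0"
    and reward_ratio: "\<And>t. t \<in> \<Theta> \<Longrightarrow> t \<noteq> 0 \<Longrightarrow>
      (deriv ^^ 3) (R t) t / (deriv ^^ 2) (R t) t = C / t"
    and reward_deriv5: "\<And>t. t \<in> \<Theta> \<Longrightarrow> bounded_fifth_deriv_between (R t) (P t) t est"
    and reward_deriv5_adjusted: "bounded_fifth_deriv_between (R \<theta>) (P \<theta>) \<theta>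
      (\<lambda>n \<omega>. adjusted_estimate C n (est n \<omega>) (var_est n \<omega>))"
    and var_est_integrable: "\<And>n j. n \<ge> 1 \<Longrightarrow> integrable (P \<theta>) (\<lambda>\<omega>. (var_est n \<omega> - \<sigma>\<^sup>2) ^ j)"
    and var_est_consistent: "consistent_estimator (P \<theta>) var_est (\<sigma>\<^sup>2)"
    and var_est_bias: "(\<lambda>n. \<integral>\<omega>. (var_est n \<omega> - \<sigma>\<^sup>2) \<partial>P \<theta>) \<in> o(\<lambda>n. 1 / real n)"
    and var_est_moments: "\<And>j. j \<ge> 2 \<Longrightarrow>
      (\<lambda>n. \<integral>\<omega>. (var_est n \<omega> - \<sigma>\<^sup>2) ^ j \<partial>P \<theta>) \<in> O(\<lambda>n. 1 / real n ^ j)"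
    and cross_moment:
      "(\<lambda>n. \<integral>\<omega>. (est n \<omega> - \<theta>) * (var_est n \<omega> - \<sigma>\<^sup>2) \<partial>P \<theta>) \<in> o(\<lambda>n. 1 / real n)"
    and eps_pos: "\<epsilon> > 0"
    and est_away_from_0: "\<And>n. n \<ge> 1 \<Longrightarrow> \<P>(\<omega> in P \<theta>. \<bar>est n \<omega>\<bar> \<ge> \<epsilon>) = 1"
  shows "(\<forall>n\<ge>1. integrable (P \<theta>) (\<lambda>\<omega>. R \<theta> (est n \<omega>)) \<and>
           integrable (P \<theta>) (\<lambda>\<omega>. R \<theta> (adjusted_estimate C n (est n \<omega>) (var_est n \<omega>)))) \<and>
    ((\<lambda>n. (real n)\<^sup>2 *
        ((\<integral>\<omega>. R \<theta> (adjusted_estimate C n (est n \<omega>) (var_est n \<omega>)) \<partial>P \<theta>) -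
         (\<integral>\<omega>. R \<theta> (est n \<omega>) \<partial>P \<theta>)))
      \<longlonglongrightarrow> - ((deriv ^^ 2) (R \<theta>) \<theta> * (2 - C)\<^sup>2 * \<sigma> ^ 4 / (8 * \<theta>\<^sup>2))) \<and>
    - ((deriv ^^ 2) (R \<theta>) \<theta> * (2 - C)\<^sup>2 * \<sigma> ^ 4 / (8 * \<theta>\<^sup>2)) \<ge> 0"
proof -

  \<comment> \<open>The errors of the estimates and their moments\<close>
  interpret prob_space "P \<theta>"
    using prob true_param by blast
  let ?M = "P \<theta>"
  \<comment> \<open>\<open>V\<close> is the centred form of \<open>s\<close>. The convention
    \<open>1 / 0 = 0\<close> makes \<open>u\<close> total; it matters only on a null set when
    \<open>n \<ge> 1\<close>.\<close>
  define X V s u where "X n \<omega> = est n \<omega> - \<theta>" and "V n \<omega> = var_est n \<omega> - \<sigma>\<^sup>2"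
    and "s n \<omega> = var_est n \<omega>" and "u n \<omega> = 1 / est n \<omega>" for n \<omega>
  have s_eq: "s n \<omega> = V n \<omega> + \<sigma>\<^sup>2" for n \<omega>
    by (simp add: s_def V_def)
  have meas [measurable]: "est n \<in> borel_measurable ?M" "var_est n \<in> borel_measurable ?M"
    "X n \<in> borel_measurable ?M" "V n \<in> borel_measurable ?M"
    "s n \<in> borel_measurable ?M" "u n \<in> borel_measurable ?M" if "n \<ge> 1" for n
    using est_measurable[OF true_param(1) that] var_est_measurable[OF true_param(1) that]
    unfolding X_def V_def s_def u_def by measurable
  note [measurable] = reward_measurable[OF true_param(1)]
  have est_ge: "AE \<omega> in ?M. \<bar>est n \<omega>\<bar> \<ge> \<epsilon>" if "n \<ge> 1" for n
    using est_away_from_0[OF that] that by (subst (asm) prob_Collect_eq_1) auto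
  have V_integrable: "integrable ?M (\<lambda>\<omega>. V n \<omega> ^ k)" if "n \<ge> 1" for n k
    using var_est_integrable[OF that] by (simp add: V_def)
  have X_integrable: "integrable ?M (\<lambda>\<omega>. X n \<omega> ^ k)" if "n \<ge> 1" for n k
    using est_integrable[OF that] by (simp add: X_def)
  have s_bound: "\<bar>s n \<omega>\<bar> ^ k \<le> 2 ^ k * (\<bar>V n \<omega>\<bar> ^ k + \<bar>\<sigma>\<^sup>2\<bar> ^ k)" for n k \<omega>
    unfolding s_eq by (rule abs_add_power_le)
  \<comment> \<open>Three sources: the total mass for \<open>k = 0\<close>, the mean squared error
    for \<open>k = 1\<close>, and the hypothesis on higher moments, at order
    \<open>2 * k \<ge> 4\<close>, otherwise.\<close>
  have X_moments: "(\<lambda>n. \<integral>\<omega>. X n \<omega> ^ (2 * k) \<partial>?M) \<in> O(\<lambda>n. real n powr (- real k))" for k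
  proof -
    consider "k = 0" | "k = 1" | "k \<ge> 2"
      by linarith
    then show ?thesis
    proof cases
      case 1
      then show ?thesis
        by (intro landau_o.big_mono eventually_mono[OF eventually_gt_at_top[of 0]]) (auto simp: prob_space)
    next
      case 2
      have "(\<lambda>n. (\<integral>\<omega>. X n \<omega> ^ (2 * k) \<partial>?M) / real n powr (- real k)) \<longlonglongrightarrow> \<sigma>\<^sup>2"
        using est_mse by (simp add: 2 X_def powr_minus divide_inverse mult.commute)
      then show ?thesis
        by (rule bigoI_tendsto) (auto intro: eventually_mono[OF eventually_gt_at_top[of 0]])
    next
      case 3
      then show ?thesis
        using est_moments[of "2 * k"] by (simp add: X_def power_even_abs)
    qed
  qed
  \<comment> \<open>Boundedness is what the locale asks for; the decay of these moments enters at
    \<open>V_X_sq\<close> and \<open>s_sq\<close>.\<close>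
  have V_moments: "(\<lambda>n. \<integral>\<omega>. V n \<omega> ^ (2 * k) \<partial>?M) \<in> O(\<lambda>n. 1)" for k
  proof (cases "k = 0")
    case False
    then have "(\<lambda>n. \<integral>\<omega>. V n \<omega> ^ (2 * k) \<partial>?M) \<in> O(\<lambda>n. 1 / real n ^ (2 * k))"
      using var_est_moments[of "2 * k"] by (simp add: V_def)
    also have "(\<lambda>n. 1 / real n ^ (2 * k)) \<in> O(\<lambda>n. 1)"
      by (intro landau_o.big_mono eventually_mono[OF eventually_gt_at_top[of 0]]) auto
    finally show ?thesis .
  qed (simp add: prob_space)

  \<comment> \<open>Moment bounds for the variance estimate and the reciprocal\<close>
  interpret moment_bounds ?M X s u "1 / \<epsilon>"
  proof
    fix n k :: nat
    show "integrable ?M (\<lambda>\<omega>. s n \<omega> ^ k)" if "n \<ge> 1"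
    proof (rule Bochner_Integration.integrable_bound)
      show "integrable ?M (\<lambda>\<omega>. 2 ^ k * (\<bar>V n \<omega>\<bar> ^ k + \<bar>\<sigma>\<^sup>2\<bar> ^ k))"
        using integrable_abs[OF V_integrable[OF that, of k]] by (simp add: power_abs)
    qed (use that s_bound[of n _ k] in \<open>auto simp: power_abs\<close>)
    show "(\<lambda>n. \<integral>\<omega>. s n \<omega> ^ (2 * k) \<partial>?M) \<in> O(\<lambda>n. 1)"
    proof -
      have "(\<lambda>n. \<integral>\<omega>. s n \<omega> ^ (2 * k) \<partial>?M)
          \<in> O(\<lambda>n. 2 ^ (2 * k) * ((\<integral>\<omega>. V n \<omega> ^ (2 * k) \<partial>?M) + (\<sigma>\<^sup>2) ^ (2 * k)))"
      proof (rule landau_o.big_mono)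
        show "eventually (\<lambda>n. norm (\<integral>\<omega>. s n \<omega> ^ (2 * k) \<partial>?M)
            \<le> norm (2 ^ (2 * k) * ((\<integral>\<omega>. V n \<omega> ^ (2 * k) \<partial>?M) + (\<sigma>\<^sup>2) ^ (2 * k)))) sequentially"
          using eventually_ge_at_top[of 1]
        proof eventually_elim
          case (elim n)
          have "(\<integral>\<omega>. s n \<omega> ^ (2 * k) \<partial>?M)
              \<le> (\<integral>\<omega>. 2 ^ (2 * k) * (V n \<omega> ^ (2 * k) + (\<sigma>\<^sup>2) ^ (2 * k)) \<partial>?M)"
            using V_integrable[OF elim, of "2 * k"] s_bound[of n _ "2 * k"]
            by (intro integral_mono') (auto simp: power_even_abs)
          also have "\<dots> = 2 ^ (2 * k) * ((\<integral>\<omega>. V n \<omega> ^ (2 * k) \<partial>?M) + (\<sigma>\<^sup>2) ^ (2 * k))"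
            using V_integrable[OF elim, of "2 * k"] by (simp add: prob_space)
          finally show ?case
            by (simp add: zero_le_even_power')
        qed
      qed
      also have "(\<lambda>n. 2 ^ (2 * k) * ((\<integral>\<omega>. V n \<omega> ^ (2 * k) \<partial>?M) + (\<sigma>\<^sup>2) ^ (2 * k))) \<in> O(\<lambda>n. 1)"
        using V_moments[of k] by (simp add: sum_in_bigo)
      finally show ?thesis .
    qed
    show "AE \<omega> in ?M. \<bar>u n \<omega>\<bar> \<le> 1 / \<epsilon>" if "n \<ge> 1"
      using est_ge[OF that]
    proof eventually_elim
      case (elim \<omega>)
      with eps_pos show ?case
        by (auto simp: u_def intro!: divide_left_mono)
    qed
  qed (use X_integrable X_moments in auto)

  \<comment> \<open>The error of the adjusted estimate\<close>
  define a where "a = (2 - C) / 2"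
  define Y where "Y n \<omega> = X n \<omega> + a * s n \<omega> * u n \<omega> / real n" for n \<omega>
  have est_eq: "est n \<omega> = \<theta> + X n \<omega>" for n \<omega>
    by (simp add: X_def)
  have est_nonzero: "AE \<omega> in ?M. est n \<omega> \<noteq> 0" if "n \<ge> 1" for n
    using est_ge[OF that] by eventually_elim (use eps_pos in auto)
  \<comment> \<open>One factor \<open>est n \<omega>\<close> cancels against its square in the
    coefficient. By the conventions for division the identity also holds at
    \<open>est n \<omega> = 0\<close> and \<open>n = 0\<close>, so no exceptional set
    arises.\<close>
  have adj_eq: "adjusted_estimate C n (est n \<omega>) (var_est n \<omega>) = \<theta> + Y n \<omega>" for n \<omega>
    by (cases "est n \<omega> = 0"; cases "n = 0")
      (simp_all add: adjusted_estimate_def adjustment_coeff_def Y_def X_def s_def u_def a_def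
        power2_eq_square field_simps)
  have Y_measurable [measurable]: "Y n \<in> borel_measurable ?M" if "n \<ge> 1" for n
    using that unfolding Y_def by measurable
  \<comment> \<open>This is \<open>n\<^sup>2\<close> times the fifth power of the shift
    \<open>s * u / n\<close>, as it occurs in the Taylor remainder.\<close>
  have shift_null: "L1_null ?M (\<lambda>n \<omega>. real n powr (- 3) * (X n \<omega> ^ 0 * s n \<omega> ^ 5 * u n \<omega> ^ 5))"
    by (rule L1_null_X_s_u) simp
  have Y_bound: "\<bar>Y n \<omega>\<bar> ^ k \<le> 2 ^ k * (\<bar>X n \<omega>\<bar> ^ k + \<bar>a * s n \<omega> * u n \<omega> / real n\<bar> ^ k)" for n k \<omega>
    unfolding Y_def by (rule abs_add_power_le)
  have Y_integrable: "integrable ?M (\<lambda>\<omega>. Y n \<omega> ^ k)" if "n \<ge> 1" for n k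
  proof (rule Bochner_Integration.integrable_bound)
    \<comment> \<open>Without a factor \<open>X\<close> the exponent of \<open>n\<close> has to be
      negative. The exponent \<open>-1\<close> is chosen for this and is undone by the factor
      \<open>real n\<close> afterwards.\<close>
    have "integrable ?M (\<lambda>\<omega>. real n powr (- 1) * (X n \<omega> ^ 0 * s n \<omega> ^ k * u n \<omega> ^ k))"
      by (rule L1_null_integrable[OF L1_null_X_s_u that]) simp
    then have "integrable ?M (\<lambda>\<omega>. (a / real n) ^ k * real n * (real n powr (- 1) * (X n \<omega> ^ 0 * s n \<omega> ^ k * u n \<omega> ^ k)))"
      by (rule integrable_mult_right)
    also have "(\<lambda>\<omega>. (a / real n) ^ k * real n * (real n powr (- 1) * (X n \<omega> ^ 0 * s n \<omega> ^ k * u n \<omega> ^ k)))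
        = (\<lambda>\<omega>. (a * s n \<omega> * u n \<omega> / real n) ^ k)"
      using that by (intro ext) (simp add: powr_minus power_mult_distrib power_divide field_simps)
    finally have "integrable ?M (\<lambda>\<omega>. (a * s n \<omega> * u n \<omega> / real n) ^ k)" .
    from integrable_abs[OF this] integrable_abs[OF X_integrable[OF that, of k]]
    show "integrable ?M (\<lambda>\<omega>. 2 ^ k * (\<bar>X n \<omega>\<bar> ^ k + \<bar>a * s n \<omega> * u n \<omega> / real n\<bar> ^ k))"
      unfolding power_abs by simp
  qed (use that Y_bound[of n _ k] in \<open>auto simp: power_abs\<close>)

  \<comment> \<open>Taylor expansion of both rewards at the true parameter\<close>
  define c where "c m = (deriv ^^ m) (R \<theta>) \<theta> / fact m" for m
  define T where "T h = (\<Sum>m<5. c m * h ^ m)" for h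
  obtain B where B: "\<And>n. n \<ge> 1 \<Longrightarrow> AE \<omega> in ?M. \<bar>R \<theta> (est n \<omega>) - T (X n \<omega>)\<bar> \<le> B * \<bar>X n \<omega>\<bar> ^ 5"
    using bounded_fifth_deriv_between_taylor[OF reward_deriv5[OF true_param(1)]]
    unfolding T_def c_def X_def by blast
  obtain B' where B': "\<And>n. n \<ge> 1 \<Longrightarrow> AE \<omega> in ?M. \<bar>R \<theta> (\<theta> + Y n \<omega>) - T (Y n \<omega>)\<bar> \<le> B' * \<bar>Y n \<omega>\<bar> ^ 5"
    using bounded_fifth_deriv_between_taylor[OF reward_deriv5_adjusted]
    unfolding T_def c_def adj_eq add_diff_cancel_left' by blast
  have reward_est_integrable: "integrable ?M (\<lambda>\<omega>. R \<theta> (est n \<omega>))" if "n \<ge> 1" for n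
    using B[OF that] that unfolding T_def
    by (intro integrable_of_taylor_bound[OF _ X_integrable]) auto
  have reward_adj_integrable: "integrable ?M (\<lambda>\<omega>. R \<theta> (\<theta> + Y n \<omega>))" if "n \<ge> 1" for n
    using B'[OF that] that unfolding T_def
    by (intro integrable_of_taylor_bound[OF _ Y_integrable]) auto

  define c\<^sub>2 c\<^sub>3 c\<^sub>4 where "c\<^sub>2 = (deriv ^^ 2) (R \<theta>) \<theta>" and "c\<^sub>3 = (deriv ^^ 3) (R \<theta>) \<theta>"
    and "c\<^sub>4 = (deriv ^^ 4) (R \<theta>) \<theta>"
  have "c\<^sub>2 < 0"
    using reward_deriv2[OF true_param(1)] by (simp add: c\<^sub>2_def)
  have c\<^sub>3: "c\<^sub>3 = C * c\<^sub>2 / \<theta>"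
    using reward_ratio[OF true_param] \<open>c\<^sub>2 < 0\<close> unfolding c\<^sub>2_def c\<^sub>3_def by (simp add: field_simps)
  \<comment> \<open>The linear term vanishes by the first-order condition. A linear term would
    contribute \<open>n * s * u\<close> to the scaled difference, which is unbounded in
    general.\<close>
  have T_eq: "T h = c 0 + c\<^sub>2 / 2 * h\<^sup>2 + c\<^sub>3 / 6 * h ^ 3 + c\<^sub>4 / 24 * h ^ 4" for h
  proof -
    have "c 1 = 0" "c\<^sub>2 = 2 * c 2" "c\<^sub>3 = 6 * c 3" "c\<^sub>4 = 24 * c 4"
      using reward_deriv1[OF true_param(1)] unfolding c_def c\<^sub>2_def c\<^sub>3_def c\<^sub>4_def
      by (simp_all add: fact_numeral)
    moreover have "{..<5} = {0, 1, 2, 3, 4 :: nat}"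
      by auto
    ultimately show ?thesis
      by (simp add: T_def)
  qed

  \<comment> \<open>Separation of the main terms from those vanishing in mean\<close>
  define b\<^sub>1 b\<^sub>2 b\<^sub>3 where "b\<^sub>1 = c\<^sub>2 * a / \<theta>" and "b\<^sub>2 = c\<^sub>3 * a / (2 * \<theta>) - c\<^sub>2 * a / \<theta>\<^sup>2"
    and "b\<^sub>3 = c\<^sub>2 * a\<^sup>2 / (2 * \<theta>\<^sup>2)"
  define main where "main n \<omega> = b\<^sub>1 * (real n * (s n \<omega> * X n \<omega>)) + b\<^sub>2 * (real n * (s n \<omega> * (X n \<omega>)\<^sup>2))
    + b\<^sub>3 * (s n \<omega>)\<^sup>2" for n \<omega>
  define G where "G n \<omega> = (real n)\<^sup>2 * (R \<theta> (\<theta> + Y n \<omega>) - R \<theta> (est n \<omega>)) - main n \<omega>" for n \<omega>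
  \<comment> \<open>The summands are those of \<open>adjustment_expansion\<close>, with trivial
    exponents written out so that each matches \<open>L1_null_X_s_u\<close>.\<close>
  define err where "err n \<omega> =
      (c\<^sub>2 * a / \<theta>\<^sup>2 - c\<^sub>3 * a / (2 * \<theta>) + c\<^sub>4 * a / 6) * (real n powr 1 * (X n \<omega> ^ 3 * s n \<omega> ^ 1 * u n \<omega> ^ 1))
    + (c\<^sub>3 * a\<^sup>2 / 2 - c\<^sub>2 * a\<^sup>2 / \<theta>) * (real n powr 0 * (X n \<omega> ^ 1 * s n \<omega> ^ 2 * u n \<omega> ^ 2))
    + (c\<^sub>4 * a\<^sup>2 / 4 - c\<^sub>2 * a\<^sup>2 / (2 * \<theta>\<^sup>2)) * (real n powr 0 * (X n \<omega> ^ 2 * s n \<omega> ^ 2 * u n \<omega> ^ 2))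
    + c\<^sub>3 * a ^ 3 / 6 * (real n powr (- 1) * (X n \<omega> ^ 0 * s n \<omega> ^ 3 * u n \<omega> ^ 3))
    + c\<^sub>4 * a ^ 3 / 6 * (real n powr (- 1) * (X n \<omega> ^ 1 * s n \<omega> ^ 3 * u n \<omega> ^ 3))
    + c\<^sub>4 * a ^ 4 / 24 * (real n powr (- 2) * (X n \<omega> ^ 0 * s n \<omega> ^ 4 * u n \<omega> ^ 4))" for n \<omega>
  \<comment> \<open>The factor 32 is the \<open>2 ^ 5\<close> of \<open>Y_bound\<close>. The
    expansion stops at order four because 5 is the least \<open>i\<close> with
    \<open>2 < i / 2\<close>, so that \<open>n\<^sup>2\<close> times the fifth power of the error
    still vanishes in mean.\<close>
  define rem where "rem n \<omega> = (\<bar>B\<bar> + 32 * \<bar>B'\<bar>) * \<bar>real n powr 2 * (X n \<omega> ^ 5 * s n \<omega> ^ 0)\<bar>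
    + 32 * \<bar>B'\<bar> * \<bar>a\<bar> ^ 5 * \<bar>real n powr (- 3) * (X n \<omega> ^ 0 * s n \<omega> ^ 5 * u n \<omega> ^ 5)\<bar>" for n \<omega>
  have err_null: "L1_null ?M err"
    unfolding err_def by (intro L1_null_add L1_null_cmult L1_null_X_s_u) auto
  have rem_null: "L1_null ?M rem"
    unfolding rem_def by (intro L1_null_add L1_null_cmult L1_null_abs L1_null_X_s shift_null) simp
  have G_null: "L1_null ?M G"
  proof (rule L1_null_bound)
    show "L1_null ?M (\<lambda>n \<omega>. \<bar>err n \<omega>\<bar> + rem n \<omega>)"
      by (intro L1_null_add L1_null_abs err_null rem_null)
    show "G n \<in> borel_measurable ?M" if "n \<ge> 1" for n
      using that unfolding G_def main_def by measurable
    \<comment> \<open>The Taylor polynomials contribute exactly \<open>main + err\<close>; what is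
      left is \<open>n\<^sup>2\<close> times the difference of the two remainders \<open>r'\<close>
      and \<open>r\<close>.\<close>
    show "AE \<omega> in ?M. \<bar>G n \<omega>\<bar> \<le> \<bar>err n \<omega>\<bar> + rem n \<omega>" if "n \<ge> 1" for n
      using B[OF that] B'[OF that] est_nonzero[OF that]
    proof eventually_elim
      case (elim \<omega>)
      define r r' where "r = R \<theta> (est n \<omega>) - T (X n \<omega>)" and "r' = R \<theta> (\<theta> + Y n \<omega>) - T (Y n \<omega>)"
      have "(real n)\<^sup>2 * (T (Y n \<omega>) - T (X n \<omega>)) = (real n)\<^sup>2 * (c\<^sub>2 / 2 * ((Y n \<omega>)\<^sup>2 - (X n \<omega>)\<^sup>2)
          + c\<^sub>3 / 6 * (Y n \<omega> ^ 3 - X n \<omega> ^ 3) + c\<^sub>4 / 24 * (Y n \<omega> ^ 4 - X n \<omega> ^ 4))"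
        unfolding T_eq by (simp add: algebra_simps)
      also have "\<dots> = main n \<omega> + err n \<omega>"
      proof -
        have u: "u n \<omega> * (\<theta> + X n \<omega>) = 1"
          using elim(3) by (simp add: u_def X_def)
        have N: "real n \<noteq> 0"
          using that by simp
        have powr: "real n powr 1 = real n" "real n powr 0 = 1"
          "real n powr (- 1) = 1 / real n" "real n powr (- 2) = 1 / (real n)\<^sup>2"
          using that by (simp_all add: powr_minus divide_inverse)
        show ?thesis
          unfolding Y_def adjustment_expansion[OF u true_param(2) N] main_def err_def b\<^sub>1_def b\<^sub>2_def b\<^sub>3_def
          by (simp only: powr power_0 power_one_right mult_1_left times_divide_eq_left add.assoc)
      qed
      finally have "G n \<omega> = err n \<omega> + (real n)\<^sup>2 * (r' - r)"
        by (simp add: G_def r_def r'_def algebra_simps)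
      moreover have "(real n)\<^sup>2 * \<bar>r' - r\<bar> \<le> rem n \<omega>"
      proof -
        have "\<bar>r\<bar> \<le> \<bar>B\<bar> * \<bar>X n \<omega>\<bar> ^ 5"
          using elim(1) unfolding r_def by (rule order_trans) (auto intro: mult_right_mono)
        moreover have "\<bar>r'\<bar> \<le> \<bar>B'\<bar> * (2 ^ 5 * (\<bar>X n \<omega>\<bar> ^ 5 + \<bar>a * s n \<omega> * u n \<omega> / real n\<bar> ^ 5))"
        proof -
          have "\<bar>r'\<bar> \<le> \<bar>B'\<bar> * \<bar>Y n \<omega>\<bar> ^ 5"
            using elim(2) unfolding r'_def by (rule order_trans) (auto intro: mult_right_mono)
          also have "\<dots> \<le> \<bar>B'\<bar> * (2 ^ 5 * (\<bar>X n \<omega>\<bar> ^ 5 + \<bar>a * s n \<omega> * u n \<omega> / real n\<bar> ^ 5))"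
            by (intro mult_left_mono Y_bound) auto
          finally show ?thesis .
        qed
        ultimately have "\<bar>r' - r\<bar> \<le> \<bar>B'\<bar> * (2 ^ 5 * (\<bar>X n \<omega>\<bar> ^ 5 + \<bar>a * s n \<omega> * u n \<omega> / real n\<bar> ^ 5))
            + \<bar>B\<bar> * \<bar>X n \<omega>\<bar> ^ 5"
          by (intro order_trans[OF abs_triangle_ineq4] add_mono)
        also have "\<dots> = (\<bar>B\<bar> + 32 * \<bar>B'\<bar>) * \<bar>X n \<omega>\<bar> ^ 5 + 32 * \<bar>B'\<bar> * \<bar>a * s n \<omega> * u n \<omega> / real n\<bar> ^ 5"
          by (simp add: algebra_simps)
        finally have "\<bar>r' - r\<bar> \<le> (\<bar>B\<bar> + 32 * \<bar>B'\<bar>) * \<bar>X n \<omega>\<bar> ^ 5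
            + 32 * \<bar>B'\<bar> * \<bar>a * s n \<omega> * u n \<omega> / real n\<bar> ^ 5" .
        then have "(real n)\<^sup>2 * \<bar>r' - r\<bar> \<le> (real n)\<^sup>2 *
            ((\<bar>B\<bar> + 32 * \<bar>B'\<bar>) * \<bar>X n \<omega>\<bar> ^ 5 + 32 * \<bar>B'\<bar> * \<bar>a * s n \<omega> * u n \<omega> / real n\<bar> ^ 5)"
          by (rule mult_left_mono) simp
        also have "\<dots> = (\<bar>B\<bar> + 32 * \<bar>B'\<bar>) * ((real n)\<^sup>2 * \<bar>X n \<omega>\<bar> ^ 5)
            + 32 * \<bar>B'\<bar> * ((real n)\<^sup>2 * \<bar>a * s n \<omega> * u n \<omega> / real n\<bar> ^ 5)"
          by (simp only: distrib_left mult_ac)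
        also have "(real n)\<^sup>2 * \<bar>X n \<omega>\<bar> ^ 5 = \<bar>real n powr 2 * (X n \<omega> ^ 5 * s n \<omega> ^ 0)\<bar>"
          by (simp add: abs_mult power_abs)
        also have "(real n)\<^sup>2 * \<bar>a * s n \<omega> * u n \<omega> / real n\<bar> ^ 5
            = \<bar>a\<bar> ^ 5 * \<bar>real n powr (- 3) * (X n \<omega> ^ 0 * s n \<omega> ^ 5 * u n \<omega> ^ 5)\<bar>"
          using that by (simp add: abs_mult power_abs power_mult_distrib power_divide powr_minus
              field_simps eval_nat_numeral)
        finally show ?thesis
          by (simp add: rem_def mult.assoc)
      qed
      moreover have "\<bar>(real n)\<^sup>2 * (r' - r)\<bar> = (real n)\<^sup>2 * \<bar>r' - r\<bar>"
        by (simp add: abs_mult)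
      ultimately show ?case
        using abs_triangle_ineq[of "err n \<omega>" "(real n)\<^sup>2 * (r' - r)"] by linarith
    qed
  qed

  \<comment> \<open>Limits of the three main expectations\<close>
  have V_X_sq: "(\<lambda>n. real n * (\<integral>\<omega>. V n \<omega> * (X n \<omega>)\<^sup>2 \<partial>?M)) \<longlonglongrightarrow> 0"
  proof (rule Lim_null_comparison)
    \<comment> \<open>Both \<open>V\<close> and \<open>X\<^sup>2\<close> have root mean square of
      order \<open>1 / n\<close>, so their product has mean of order \<open>1 / n\<^sup>2\<close>,
      which beats the factor \<open>n\<close>.\<close>
    have "(\<lambda>n. \<integral>\<omega>. \<bar>V n \<omega> * (X n \<omega>)\<^sup>2\<bar> \<partial>?M) \<in> O(\<lambda>n. real n powr (- 1 + - 1))"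
    proof (rule integral_abs_mult_bigo)
      show "(\<lambda>n. \<integral>\<omega>. (V n \<omega>)\<^sup>2 \<partial>?M) \<in> O(\<lambda>n. real n powr (2 * - 1))"
        using var_est_moments[of 2] by (simp add: V_def powr_minus divide_inverse)
      show "(\<lambda>n. \<integral>\<omega>. ((X n \<omega>)\<^sup>2)\<^sup>2 \<partial>?M) \<in> O(\<lambda>n. real n powr (2 * - 1))"
        using X_moments[of 2] by (simp flip: power_mult)
    qed (use V_integrable[of _ 2] X_integrable[of _ 4] in \<open>auto simp flip: power_mult\<close>)
    from powr_mult_bigo_tendsto_zero[OF this, of 1]
    show "(\<lambda>n. real n powr 1 * (\<integral>\<omega>. \<bar>V n \<omega> * (X n \<omega>)\<^sup>2\<bar> \<partial>?M)) \<longlonglongrightarrow> 0"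
      by simp
    show "eventually (\<lambda>n. norm (real n * (\<integral>\<omega>. V n \<omega> * (X n \<omega>)\<^sup>2 \<partial>?M))
        \<le> real n powr 1 * (\<integral>\<omega>. \<bar>V n \<omega> * (X n \<omega>)\<^sup>2\<bar> \<partial>?M)) sequentially"
    proof (intro always_eventually allI)
      fix n
      have "\<bar>\<integral>\<omega>. V n \<omega> * (X n \<omega>)\<^sup>2 \<partial>?M\<bar> \<le> (\<integral>\<omega>. \<bar>V n \<omega> * (X n \<omega>)\<^sup>2\<bar> \<partial>?M)"
        by (rule integral_abs_bound)
      then show "norm (real n * (\<integral>\<omega>. V n \<omega> * (X n \<omega>)\<^sup>2 \<partial>?M))
          \<le> real n powr 1 * (\<integral>\<omega>. \<bar>V n \<omega> * (X n \<omega>)\<^sup>2\<bar> \<partial>?M)"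
        by (simp add: abs_mult mult_left_mono)
    qed
  qed
  \<comment> \<open>Writing \<open>s = V + \<sigma>\<^sup>2\<close> splits the expectation into the
    cross moment and a multiple of the bias, both \<open>o(1 / n)\<close>.\<close>
  have s_X: "(\<lambda>n. real n * (\<integral>\<omega>. s n \<omega> * X n \<omega> \<partial>?M)) \<longlonglongrightarrow> 0"
  proof -
    have "(\<lambda>n. \<integral>\<omega>. X n \<omega> \<partial>?M) \<in> o(\<lambda>n. 1 / real n)"
      using est_bias by (simp add: X_def)
    then have 1: "(\<lambda>n. real n * (\<integral>\<omega>. X n \<omega> \<partial>?M)) \<longlonglongrightarrow> 0"
      by (auto dest: smalloD_tendsto simp: mult.commute)
    have 2: "(\<lambda>n. real n * (\<integral>\<omega>. X n \<omega> * V n \<omega> \<partial>?M)) \<longlonglongrightarrow> 0"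
      using smalloD_tendsto[OF cross_moment] by (simp add: X_def V_def mult.commute)
    have "(\<lambda>n. real n * (\<integral>\<omega>. X n \<omega> * V n \<omega> \<partial>?M) + \<sigma>\<^sup>2 * (real n * (\<integral>\<omega>. X n \<omega> \<partial>?M))) \<longlonglongrightarrow> 0"
      using tendsto_add[OF 2 tendsto_mult_left[OF 1, of "\<sigma>\<^sup>2"]] by simp
    then show ?thesis
    proof (rule Lim_transform_eventually)
      show "eventually (\<lambda>n. real n * (\<integral>\<omega>. X n \<omega> * V n \<omega> \<partial>?M) + \<sigma>\<^sup>2 * (real n * (\<integral>\<omega>. X n \<omega> \<partial>?M))
          = real n * (\<integral>\<omega>. s n \<omega> * X n \<omega> \<partial>?M)) sequentially"
        using eventually_ge_at_top[of 1]
      proof eventually_elim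
        case (elim n)
        have "integrable ?M (\<lambda>\<omega>. X n \<omega> * V n \<omega>)"
          using elim V_integrable[of n 2] X_integrable[of n 2] by (intro integrable_mult_squares) auto
        then have "(\<integral>\<omega>. X n \<omega> * V n \<omega> + \<sigma>\<^sup>2 * X n \<omega> \<partial>?M)
            = (\<integral>\<omega>. X n \<omega> * V n \<omega> \<partial>?M) + \<sigma>\<^sup>2 * (\<integral>\<omega>. X n \<omega> \<partial>?M)"
          using X_integrable[OF elim, of 1] by simp
        moreover have "(\<lambda>\<omega>. s n \<omega> * X n \<omega>) = (\<lambda>\<omega>. X n \<omega> * V n \<omega> + \<sigma>\<^sup>2 * X n \<omega>)"
          by (simp add: s_eq algebra_simps)
        ultimately show ?case
          by (simp add: algebra_simps)
      qed
    qed
  qed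
  \<comment> \<open>In the same splitting \<open>V\<close> contributes nothing in the limit, and the
    mean squared error supplies the second factor \<open>\<sigma>\<^sup>2\<close>.\<close>
  have s_X_sq: "(\<lambda>n. real n * (\<integral>\<omega>. s n \<omega> * (X n \<omega>)\<^sup>2 \<partial>?M)) \<longlonglongrightarrow> \<sigma> ^ 4"
  proof -
    have "(\<lambda>n. real n * (\<integral>\<omega>. V n \<omega> * (X n \<omega>)\<^sup>2 \<partial>?M) + \<sigma>\<^sup>2 * (real n * (\<integral>\<omega>. (X n \<omega>)\<^sup>2 \<partial>?M))) \<longlonglongrightarrow> \<sigma> ^ 4"
      using tendsto_add[OF V_X_sq tendsto_mult_left[OF est_mse, of "\<sigma>\<^sup>2"]]
      by (simp add: X_def flip: power_add)
    then show ?thesis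
    proof (rule Lim_transform_eventually)
      show "eventually (\<lambda>n. real n * (\<integral>\<omega>. V n \<omega> * (X n \<omega>)\<^sup>2 \<partial>?M) + \<sigma>\<^sup>2 * (real n * (\<integral>\<omega>. (X n \<omega>)\<^sup>2 \<partial>?M))
          = real n * (\<integral>\<omega>. s n \<omega> * (X n \<omega>)\<^sup>2 \<partial>?M)) sequentially"
        using eventually_ge_at_top[of 1]
      proof eventually_elim
        case (elim n)
        have "integrable ?M (\<lambda>\<omega>. V n \<omega> * (X n \<omega>)\<^sup>2)"
          using elim V_integrable[of n 2] X_integrable[of n 4]
          by (intro integrable_mult_squares) (auto simp flip: power_mult)
        then have "(\<integral>\<omega>. V n \<omega> * (X n \<omega>)\<^sup>2 + \<sigma>\<^sup>2 * (X n \<omega>)\<^sup>2 \<partial>?M)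
            = (\<integral>\<omega>. V n \<omega> * (X n \<omega>)\<^sup>2 \<partial>?M) + \<sigma>\<^sup>2 * (\<integral>\<omega>. (X n \<omega>)\<^sup>2 \<partial>?M)"
          using X_integrable[OF elim, of 2] by simp
        moreover have "(\<lambda>\<omega>. s n \<omega> * (X n \<omega>)\<^sup>2) = (\<lambda>\<omega>. V n \<omega> * (X n \<omega>)\<^sup>2 + \<sigma>\<^sup>2 * (X n \<omega>)\<^sup>2)"
          by (simp add: s_eq algebra_simps)
        ultimately show ?case
          by (simp add: algebra_simps)
      qed
    qed
  qed
  have s_sq: "(\<lambda>n. \<integral>\<omega>. (s n \<omega>)\<^sup>2 \<partial>?M) \<longlonglongrightarrow> \<sigma> ^ 4"
  proof -
    have inverse_n: "(\<lambda>n. 1 / real n) \<in> o(\<lambda>n. 1)" "(\<lambda>n. 1 / (real n)\<^sup>2) \<in> o(\<lambda>n. 1)"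
      by real_asymp+
    have "(\<lambda>n. \<integral>\<omega>. V n \<omega> \<partial>?M) \<in> o(\<lambda>n. 1)"
      using landau_o.small_trans[OF var_est_bias inverse_n(1)] by (simp add: V_def)
    then have 1: "(\<lambda>n. \<integral>\<omega>. V n \<omega> \<partial>?M) \<longlonglongrightarrow> 0"
      by (auto dest: smalloD_tendsto)
    have "(\<lambda>n. \<integral>\<omega>. (V n \<omega>)\<^sup>2 \<partial>?M) \<in> o(\<lambda>n. 1)"
      using landau_o.big_small_trans[OF var_est_moments[OF order.refl] inverse_n(2)] by (simp add: V_def)
    then have 2: "(\<lambda>n. \<integral>\<omega>. (V n \<omega>)\<^sup>2 \<partial>?M) \<longlonglongrightarrow> 0"
      by (auto dest: smalloD_tendsto)
    have "(\<lambda>n. (\<integral>\<omega>. (V n \<omega>)\<^sup>2 \<partial>?M) + (2 * \<sigma>\<^sup>2 * (\<integral>\<omega>. V n \<omega> \<partial>?M) + \<sigma> ^ 4)) \<longlonglongrightarrow> 0 + (2 * \<sigma>\<^sup>2 * 0 + \<sigma> ^ 4)"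
      by (intro tendsto_intros 1 2)
    then have "(\<lambda>n. (\<integral>\<omega>. (V n \<omega>)\<^sup>2 \<partial>?M) + (2 * \<sigma>\<^sup>2 * (\<integral>\<omega>. V n \<omega> \<partial>?M) + \<sigma> ^ 4)) \<longlonglongrightarrow> \<sigma> ^ 4"
      by simp
    then show ?thesis
    proof (rule Lim_transform_eventually)
      show "eventually (\<lambda>n. (\<integral>\<omega>. (V n \<omega>)\<^sup>2 \<partial>?M) + (2 * \<sigma>\<^sup>2 * (\<integral>\<omega>. V n \<omega> \<partial>?M) + \<sigma> ^ 4)
          = (\<integral>\<omega>. (s n \<omega>)\<^sup>2 \<partial>?M)) sequentially"
        using eventually_ge_at_top[of 1]
      proof eventually_elim
        case (elim n)
        have "(\<lambda>\<omega>. (s n \<omega>)\<^sup>2) = (\<lambda>\<omega>. (V n \<omega>)\<^sup>2 + (2 * \<sigma>\<^sup>2 * V n \<omega> + \<sigma> ^ 4))"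
          by (simp add: s_eq power2_eq_square algebra_simps eval_nat_numeral)
        then show ?case
          using V_integrable[OF elim, of 1] V_integrable[OF elim, of 2] by (simp add: prob_space)
      qed
    qed
  qed

  \<comment> \<open>The value and the sign of the limit\<close>
  define L where "L = - (c\<^sub>2 * (2 - C)\<^sup>2 * \<sigma> ^ 4 / (8 * \<theta>\<^sup>2))"
  have "(\<lambda>n. (\<integral>\<omega>. G n \<omega> \<partial>?M) + (b\<^sub>1 * (real n * (\<integral>\<omega>. s n \<omega> * X n \<omega> \<partial>?M))
      + b\<^sub>2 * (real n * (\<integral>\<omega>. s n \<omega> * (X n \<omega>)\<^sup>2 \<partial>?M)) + b\<^sub>3 * (\<integral>\<omega>. (s n \<omega>)\<^sup>2 \<partial>?M)))
      \<longlonglongrightarrow> 0 + (b\<^sub>1 * 0 + b\<^sub>2 * \<sigma> ^ 4 + b\<^sub>3 * \<sigma> ^ 4)"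
    by (intro tendsto_intros L1_null_tendsto[OF G_null] s_X s_X_sq s_sq)
  \<comment> \<open>By \<open>c\<^sub>3\<close> the sum \<open>b\<^sub>2 + b\<^sub>3\<close> equals
    \<open>c\<^sub>2 / \<theta>\<^sup>2 * (a\<^sup>2 / 2 - a * (2 - C) / 2)\<close>. As a function
    of \<open>a\<close> it is largest at \<open>a = (2 - C) / 2\<close>, because
    \<open>c\<^sub>2 < 0\<close>; this is where the adjustment coefficient comes from. There it
    equals \<open>- c\<^sub>2 * a\<^sup>2 / (2 * \<theta>\<^sup>2)\<close>.\<close>
  also have "0 + (b\<^sub>1 * 0 + b\<^sub>2 * \<sigma> ^ 4 + b\<^sub>3 * \<sigma> ^ 4) = L"
    using true_param(2) by (simp add: b\<^sub>2_def b\<^sub>3_def c\<^sub>3 a_def L_def field_simps power2_eq_square)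
  finally have "(\<lambda>n. (real n)\<^sup>2 * ((\<integral>\<omega>. R \<theta> (\<theta> + Y n \<omega>) \<partial>?M) - (\<integral>\<omega>. R \<theta> (est n \<omega>) \<partial>?M))) \<longlonglongrightarrow> L"
  proof (rule Lim_transform_eventually)
    show "eventually (\<lambda>n. (\<integral>\<omega>. G n \<omega> \<partial>?M) + (b\<^sub>1 * (real n * (\<integral>\<omega>. s n \<omega> * X n \<omega> \<partial>?M))
        + b\<^sub>2 * (real n * (\<integral>\<omega>. s n \<omega> * (X n \<omega>)\<^sup>2 \<partial>?M)) + b\<^sub>3 * (\<integral>\<omega>. (s n \<omega>)\<^sup>2 \<partial>?M))
        = (real n)\<^sup>2 * ((\<integral>\<omega>. R \<theta> (\<theta> + Y n \<omega>) \<partial>?M) - (\<integral>\<omega>. R \<theta> (est n \<omega>) \<partial>?M))) sequentially"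
      using eventually_ge_at_top[of 1]
    proof eventually_elim
      case (elim n)
      have int: "integrable ?M (\<lambda>\<omega>. s n \<omega> * X n \<omega>)" "integrable ?M (\<lambda>\<omega>. s n \<omega> * (X n \<omega>)\<^sup>2)"
        "integrable ?M (\<lambda>\<omega>. (s n \<omega>)\<^sup>2)"
        using integrable_X_s[OF elim, of 1 1] integrable_X_s[OF elim, of 2 1] integrable_X_s[OF elim, of 0 2]
        by (simp_all add: mult.commute)
      then have "(\<integral>\<omega>. main n \<omega> \<partial>?M) = b\<^sub>1 * (real n * (\<integral>\<omega>. s n \<omega> * X n \<omega> \<partial>?M))
        + b\<^sub>2 * (real n * (\<integral>\<omega>. s n \<omega> * (X n \<omega>)\<^sup>2 \<partial>?M)) + b\<^sub>3 * (\<integral>\<omega>. (s n \<omega>)\<^sup>2 \<partial>?M)"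
        and "integrable ?M (main n)"
        unfolding main_def by simp_all
      then show ?case
        using reward_est_integrable[OF elim] reward_adj_integrable[OF elim] by (simp add: G_def)
    qed
  qed
  moreover have "L \<ge> 0"
    using \<open>c\<^sub>2 < 0\<close> unfolding L_def
    by (auto intro!: divide_nonpos_nonneg mult_nonpos_nonneg)
  ultimately show ?thesis
    using reward_est_integrable reward_adj_integrable unfolding adj_eq L_def c\<^sub>2_def by blast
qed

end
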